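(* If $D$ is a principal ideal domain, then every irreducible element of $R(D)$ is primary. In particular, each nonzero nonunit of $R(D)$ can be written as a finite product of primary elements.
   Context: For an integral domain $D$, $R(D) = \left\{\begin{pmatrix} a & b \\ 0 & a \end{pmatrix} : a,b \in D\right\}$, a commutative ring with identity under matrix addition and multiplication. In a commutative ring $R$ with identity, elements $a,b$ are associates if $aR=bR$; a nonunit $a \in R$ is irreducible if $a=bc$ with $b,c\in R$ implies that $b$ or $c$ is associated with $a$; a nonzero nonunit $x\in R$ is primary if $xR$ is a primary ideal. *)

theory Defs
  imports "HOL-Algebra.Ring_Divisibility" "HOL-Analysis.Finite_Cartesian_Product"
begin

definition mat2_ring :: "('a, 'm) ring_scheme \<Rightarrow> ('a ^ 2 ^ 2) ring"
  where "mat2_ring D =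
    \<lparr>carrier = {A. \<forall>i j. A $ i $ j \<in> carrier D},
     mult = (\<lambda>A B. \<chi> i j. \<Oplus>\<^bsub>D\<^esub>k\<in>UNIV. A $ i $ k \<otimes>\<^bsub>D\<^esub> B $ k $ j),
     one = (\<chi> i j. if i = j then \<one>\<^bsub>D\<^esub> else \<zero>\<^bsub>D\<^esub>),
     zero = (\<chi> i j. \<zero>\<^bsub>D\<^esub>),
     add = (\<lambda>A B. \<chi> i j. A $ i $ j \<oplus>\<^bsub>D\<^esub> B $ i $ j)\<rparr>"

text \<open>The rows and columns of \<^typ>\<open>'a ^ 2 ^ 2\<close> are indexed by \<open>1\<close> and \<open>2 = 0\<close> of the
  type \<open>2\<close>, so \<open>toeplitz_mat D a b\<close> has first row \<open>(a, b)\<close> and second row \<open>(\<zero>, a)\<close>.\<close>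

definition toeplitz_mat :: "('a, 'm) ring_scheme \<Rightarrow> 'a \<Rightarrow> 'a \<Rightarrow> 'a ^ 2 ^ 2"
  where "toeplitz_mat D a b =
    (\<chi> i j. if i = j then a else if i = 1 then b else \<zero>\<^bsub>D\<^esub>)"

definition toeplitz_ring :: "('a, 'm) ring_scheme \<Rightarrow> ('a ^ 2 ^ 2) ring"
  where "toeplitz_ring D =
    (mat2_ring D)\<lparr>carrier := {toeplitz_mat D a b | a b. a \<in> carrier D \<and> b \<in> carrier D}\<rparr>"

definition ideal_associated :: "('a, 'm) ring_scheme \<Rightarrow> 'a \<Rightarrow> 'a \<Rightarrow> bool"
  where "ideal_associated R a b \<longleftrightarrow> PIdl\<^bsub>R\<^esub> a = PIdl\<^bsub>R\<^esub> b"

text \<open>In a ring with zero divisors the following is not equivalent to \<^const>\<open>irreducible\<close>, which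
  asks every proper divisor to be a unit.\<close>

definition irreducible_element :: "('a, 'm) ring_scheme \<Rightarrow> 'a \<Rightarrow> bool"
  where "irreducible_element R a \<longleftrightarrow>
    a \<in> carrier R \<and> a \<notin> Units R \<and>
    (\<forall>b\<in>carrier R. \<forall>c\<in>carrier R. a = b \<otimes>\<^bsub>R\<^esub> c \<longrightarrow>
       ideal_associated R b a \<or> ideal_associated R c a)"

definition primary_ideal :: "'a set \<Rightarrow> ('a, 'm) ring_scheme \<Rightarrow> bool"
  where "primary_ideal Q R \<longleftrightarrow>
    ideal Q R \<and> Q \<noteq> carrier R \<and>
    (\<forall>a\<in>carrier R. \<forall>b\<in>carrier R. a \<otimes>\<^bsub>R\<^esub> b \<in> Q \<longrightarrow>
       a \<in> Q \<or> (\<exists>n::nat. n \<ge> 1 \<and> b [^]\<^bsub>R\<^esub> n \<in> Q))"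

definition primary_element :: "('a, 'm) ring_scheme \<Rightarrow> 'a \<Rightarrow> bool"
  where "primary_element R x \<longleftrightarrow>
    x \<in> carrier R \<and> x \<noteq> \<zero>\<^bsub>R\<^esub> \<and> x \<notin> Units R \<and> primary_ideal (PIdl\<^bsub>R\<^esub> x) R"

end

theory Submission
  imports Defs "HOL-Analysis.Cartesian_Space"
begin

text \<open>
  Write \<open>\<epsilon>\<close> for the matrix with first row \<open>(0, 1)\<close> and second row \<open>(0, 0)\<close>. Since \<open>\<epsilon>\<^sup>2 = 0\<close>,
  \<open>R(D)\<close> is the ring of dual numbers \<open>a + b\<epsilon>\<close> over \<open>D\<close> (written \<open>dual a b\<close> below), and
  \<open>a + b\<epsilon>\<close> is a unit exactly when \<open>a\<close> is. The proof rests on three observations about the diagonal entry \<open>a\<close>.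

  If \<open>a\<close> is a nonunit dividing a power \<open>p\<^sup>n\<close> of a prime, then \<open>x = a + b\<epsilon>\<close> is primary, because modulo
  \<open>x\<close> every element is nilpotent or invertible. Indeed \<open>x\<close> divides the norm \<open>(a + b\<epsilon>)(a - b\<epsilon>) = a\<^sup>2\<close>,
  hence also \<open>p\<^sup>2\<^sup>n\<close>; an element \<open>c + d\<epsilon>\<close> with \<open>p\<close> dividing \<open>c\<close> has a square divisible by \<open>p\<close>, and one
  with \<open>p\<close> not dividing \<open>c\<close> divides its norm \<open>c\<^sup>2\<close>, which is comaximal with \<open>p\<^sup>2\<^sup>n\<close>
  (\<open>primary_dual_prime_power\<close>).

  If \<open>a = 0\<close> and \<open>b\<close> is a unit, then \<open>a + b\<epsilon>\<close> generates the ideal of all \<open>d\<epsilon>\<close>, which is prime with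
  quotient \<open>D\<close> (\<open>primary_dual_nilpotent\<close>).

  If \<open>a = a\<^sub>1 a\<^sub>2\<close> with \<open>a\<^sub>1\<close> and \<open>a\<^sub>2\<close> comaximal, then \<open>a + b\<epsilon> = (a\<^sub>1 + u\<epsilon>)(a\<^sub>2 + v\<epsilon>)\<close> for suitable \<open>u\<close> and
  \<open>v\<close>, because the equation \<open>a\<^sub>1 v + a\<^sub>2 u = b\<close> is solvable (\<open>dual_split_comaximal\<close>).

  For a nonzero nonunit \<open>a\<close>, splitting off the full power of one prime dividing \<open>a\<close> therefore produces
  a primary factor. An irreducible element must be associated with that factor, so it is primary; repeating the splitting
  writes an arbitrary element as a product of primary ones. For \<open>a = 0\<close> the factorization
  \<open>b\<epsilon> = b \<cdot> \<epsilon>\<close> reduces both claims to the previous cases.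
\<close>

section \<open>The dual numbers over a commutative ring\<close>

lemma toeplitz_mat_eq_iff: "toeplitz_mat D a b = toeplitz_mat D c d \<longleftrightarrow> a = c \<and> b = d"
  by (auto simp: toeplitz_mat_def vec_eq_iff forall_2)

context cring
begin

abbreviation dual_ring :: "('a ^ 2 ^ 2) ring" (\<open>\<T>\<close>)
  where "\<T> \<equiv> toeplitz_ring R"

abbreviation dual :: "'a \<Rightarrow> 'a \<Rightarrow> 'a ^ 2 ^ 2"
  where "dual a b \<equiv> toeplitz_mat R a b"

lemma finsum_2: "f \<in> UNIV \<rightarrow> carrier R \<Longrightarrow> (\<Oplus>k\<in>(UNIV :: 2 set). f k) = f 1 \<oplus> f 2"
  by (subst UNIV_2, subst finsum_insert) (auto simp: Pi_iff)

lemma mat2_mult_entry: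
  assumes "\<And>i j. A $ i $ j \<in> carrier R" "\<And>i j. B $ i $ j \<in> carrier R"
  shows "(A \<otimes>\<^bsub>mat2_ring R\<^esub> B) $ i $ j = A $ i $ 1 \<otimes> B $ 1 $ j \<oplus> A $ i $ 2 \<otimes> B $ 2 $ j"
  using assms by (simp add: mat2_ring_def finsum_2)

lemma dual_mult:
  assumes "a \<in> carrier R" "b \<in> carrier R" "c \<in> carrier R" "d \<in> carrier R"
  shows "dual a b \<otimes>\<^bsub>\<T>\<^esub> dual c d = dual (a \<otimes> c) (a \<otimes> d \<oplus> b \<otimes> c)"
proof -
  have entry: "toeplitz_mat R u v $ i $ j \<in> carrier R"
    if "u \<in> carrier R" "v \<in> carrier R" for u v i j
    using that by (simp add: toeplitz_mat_def)
  have "dual a b \<otimes>\<^bsub>mat2_ring R\<^esub> dual c d = dual (a \<otimes> c) (a \<otimes> d \<oplus> b \<otimes> c)"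
    using assms by (simp add: vec_eq_iff forall_2 mat2_mult_entry entry)
      (simp add: toeplitz_mat_def)
  then show ?thesis by (simp add: toeplitz_ring_def)
qed

lemma dual_add: "a \<in> carrier R \<Longrightarrow> b \<in> carrier R \<Longrightarrow> c \<in> carrier R \<Longrightarrow> d \<in> carrier R \<Longrightarrow>
    dual a b \<oplus>\<^bsub>\<T>\<^esub> dual c d = dual (a \<oplus> c) (b \<oplus> d)"
  by (simp add: toeplitz_ring_def mat2_ring_def toeplitz_mat_def vec_eq_iff)

lemma dual_zero: "\<zero>\<^bsub>\<T>\<^esub> = dual \<zero> \<zero>"
  by (simp add: toeplitz_ring_def mat2_ring_def toeplitz_mat_def vec_eq_iff)

lemma dual_one: "\<one>\<^bsub>\<T>\<^esub> = dual \<one> \<zero>"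
  by (simp add: toeplitz_ring_def mat2_ring_def toeplitz_mat_def vec_eq_iff)

lemma dual_carrier: "carrier \<T> = {dual a b | a b. a \<in> carrier R \<and> b \<in> carrier R}"
  by (simp add: toeplitz_ring_def)

lemma dual_closed: "a \<in> carrier R \<Longrightarrow> b \<in> carrier R \<Longrightarrow> dual a b \<in> carrier \<T>"
  by (auto simp: dual_carrier)

lemma dualE:
  assumes "x \<in> carrier \<T>"
  obtains a b where "a \<in> carrier R" "b \<in> carrier R" "x = dual a b"
  using assms by (auto simp: dual_carrier)

lemma dual_cring: "cring \<T>"
proof (rule cringI)
  show "abelian_group \<T>"
  proof (rule abelian_groupI)
    fix x assume "x \<in> carrier \<T>"
    then obtain a b where "a \<in> carrier R" "b \<in> carrier R" "x = dual a b" by (rule dualE)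
    then show "\<exists>y\<in>carrier \<T>. y \<oplus>\<^bsub>\<T>\<^esub> x = \<zero>\<^bsub>\<T>\<^esub>"
      by (intro bexI[of _ "dual (\<ominus> a) (\<ominus> b)"]) (auto simp: dual_add dual_zero dual_closed l_neg)
  qed (auto simp: dual_add dual_zero a_ac dual_closed toeplitz_mat_eq_iff elim!: dualE)
  show "comm_monoid \<T>"
  proof (rule comm_monoidI)
    fix x y z assume "x \<in> carrier \<T>" "y \<in> carrier \<T>" "z \<in> carrier \<T>"
    then show "x \<otimes>\<^bsub>\<T>\<^esub> y \<otimes>\<^bsub>\<T>\<^esub> z = x \<otimes>\<^bsub>\<T>\<^esub> (y \<otimes>\<^bsub>\<T>\<^esub> z)"
      by (elim dualE) (simp add: dual_mult toeplitz_mat_eq_iff l_distr r_distr m_assoc a_assoc)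
  next
    fix x y assume "x \<in> carrier \<T>" "y \<in> carrier \<T>"
    then show "x \<otimes>\<^bsub>\<T>\<^esub> y = y \<otimes>\<^bsub>\<T>\<^esub> x"
      by (elim dualE) (simp add: dual_mult toeplitz_mat_eq_iff m_comm a_comm)
  qed (auto elim!: dualE simp: dual_mult dual_one dual_closed)
  fix x y z assume "x \<in> carrier \<T>" "y \<in> carrier \<T>" "z \<in> carrier \<T>"
  then show "(x \<oplus>\<^bsub>\<T>\<^esub> y) \<otimes>\<^bsub>\<T>\<^esub> z = x \<otimes>\<^bsub>\<T>\<^esub> z \<oplus>\<^bsub>\<T>\<^esub> y \<otimes>\<^bsub>\<T>\<^esub> z"
    by (elim dualE) (simp add: dual_mult dual_add toeplitz_mat_eq_iff l_distr r_distr a_ac)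
qed

lemma dual_diagonal_power:
  assumes "a \<in> carrier R"
  shows "dual a \<zero> [^]\<^bsub>\<T>\<^esub> (n :: nat) = dual (a [^] n) \<zero>"
proof -
  interpret T: cring \<T> by (rule dual_cring)
  show ?thesis
    using assms by (induction n) (simp_all add: dual_one dual_mult)
qed

lemma dual_Units_iff:
  assumes "a \<in> carrier R" "b \<in> carrier R"
  shows "dual a b \<in> Units \<T> \<longleftrightarrow> a \<in> Units R"
proof -
  interpret T: cring \<T> by (rule dual_cring)
  show ?thesis
  proof
    assume "dual a b \<in> Units \<T>"
    then obtain y where "y \<in> carrier \<T>" "dual a b \<otimes>\<^bsub>\<T>\<^esub> y = \<one>\<^bsub>\<T>\<^esub>"
      by (auto simp: Units_def)
    then obtain c where "c \<in> carrier R" "a \<otimes> c = \<one>"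
      using assms by (auto elim!: dualE simp: dual_mult dual_one toeplitz_mat_eq_iff)
    then show "a \<in> Units R"
      using assms unfolding Units_def by (auto simp: m_comm intro!: bexI[of _ c])
  next
    assume "a \<in> Units R"
    then obtain c where c: "c \<in> carrier R" "a \<otimes> c = \<one>"
      using Units_r_inv Units_inv_closed by blast
    \<comment> \<open>The inverse of \<open>a + b\<epsilon>\<close> is \<open>c - c\<^sup>2b\<epsilon>\<close>.\<close>
    have "a \<otimes> (\<ominus> (c \<otimes> c \<otimes> b)) \<oplus> b \<otimes> c = (\<one> \<ominus> a \<otimes> c) \<otimes> c \<otimes> b"
      using assms c(1) by algebra
    then have "dual a b \<otimes>\<^bsub>\<T>\<^esub> dual c (\<ominus> (c \<otimes> c \<otimes> b)) \<in> Units \<T>"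
      using assms c by (simp add: dual_mult minus_eq r_neg flip: dual_one)
    then show "dual a b \<in> Units \<T>"
      by (rule T.unit_factor) (use assms c(1) in \<open>simp_all add: dual_closed\<close>)
  qed
qed

lemma dual_PIdl_iff:
  assumes "a \<in> carrier R" "b \<in> carrier R"
  shows "x \<in> PIdl\<^bsub>\<T>\<^esub> (dual a b) \<longleftrightarrow>
    (\<exists>c\<in>carrier R. \<exists>d\<in>carrier R. x = dual (c \<otimes> a) (c \<otimes> b \<oplus> d \<otimes> a))"
proof
  assume "x \<in> PIdl\<^bsub>\<T>\<^esub> (dual a b)"
  then obtain y where "y \<in> carrier \<T>" "x = y \<otimes>\<^bsub>\<T>\<^esub> dual a b" by (auto simp: cgenideal_def)
  then show "\<exists>c\<in>carrier R. \<exists>d\<in>carrier R. x = dual (c \<otimes> a) (c \<otimes> b \<oplus> d \<otimes> a)"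
    by (elim dualE) (use assms dual_mult in blast)
next
  assume "\<exists>c\<in>carrier R. \<exists>d\<in>carrier R. x = dual (c \<otimes> a) (c \<otimes> b \<oplus> d \<otimes> a)"
  then obtain c d where cd: "c \<in> carrier R" "d \<in> carrier R"
      "x = dual (c \<otimes> a) (c \<otimes> b \<oplus> d \<otimes> a)" by blast
  then have "x = dual c d \<otimes>\<^bsub>\<T>\<^esub> dual a b" using assms by (simp add: dual_mult)
  then show "x \<in> PIdl\<^bsub>\<T>\<^esub> (dual a b)"
    using cd dual_closed unfolding cgenideal_def by blast
qed

lemma PIdl_dual_imp_divides:
  assumes "a \<in> carrier R" "b \<in> carrier R" "dual c d \<in> PIdl\<^bsub>\<T>\<^esub> (dual a b)"
  shows "a divides c"
  using assms by (auto simp: dual_PIdl_iff toeplitz_mat_eq_iff factor_def m_comm)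

section \<open>Comaximal elements\<close>

definition comaximal :: "'a \<Rightarrow> 'a \<Rightarrow> bool"
  where "comaximal a b \<longleftrightarrow> (\<exists>s\<in>carrier R. \<exists>t\<in>carrier R. s \<otimes> a \<oplus> t \<otimes> b = \<one>)"

lemma comaximal_mult:
  assumes "comaximal a c" "comaximal b c" "a \<in> carrier R" "b \<in> carrier R" "c \<in> carrier R"
  shows "comaximal (a \<otimes> b) c"
proof -
  obtain s t u v where st: "s \<in> carrier R" "t \<in> carrier R" "s \<otimes> a \<oplus> t \<otimes> c = \<one>"
    and uv: "u \<in> carrier R" "v \<in> carrier R" "u \<otimes> b \<oplus> v \<otimes> c = \<one>"
    using assms(1,2) by (auto simp: comaximal_def)
  have "(s \<otimes> a \<oplus> t \<otimes> c) \<otimes> (u \<otimes> b \<oplus> v \<otimes> c) =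
      (s \<otimes> u) \<otimes> (a \<otimes> b) \<oplus> (s \<otimes> a \<otimes> v \<oplus> t \<otimes> (u \<otimes> b \<oplus> v \<otimes> c)) \<otimes> c"
    using st(1,2) uv(1,2) assms(3-5) by algebra
  then have "(s \<otimes> u) \<otimes> (a \<otimes> b) \<oplus> (s \<otimes> a \<otimes> v \<oplus> t \<otimes> (u \<otimes> b \<oplus> v \<otimes> c)) \<otimes> c = \<one>"
    using st(3) uv(3) by simp
  then show ?thesis
    using st uv assms(3-5) unfolding comaximal_def
    by (intro bexI[of _ "s \<otimes> u"] bexI[of _ "s \<otimes> a \<otimes> v \<oplus> t \<otimes> (u \<otimes> b \<oplus> v \<otimes> c)"]) auto
qed

lemma comaximal_power:
  assumes "comaximal a c" "a \<in> carrier R" "c \<in> carrier R"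
  shows "comaximal (a [^] (n :: nat)) c"
proof (induction n)
  case 0
  have "\<one> \<otimes> \<one> \<oplus> \<zero> \<otimes> c = \<one>" using assms by simp
  then show ?case unfolding comaximal_def by (metis nat_pow_0 one_closed zero_closed)
qed (use assms in \<open>simp add: comaximal_mult\<close>)

lemma comaximal_sym: "comaximal a c \<Longrightarrow> a \<in> carrier R \<Longrightarrow> c \<in> carrier R \<Longrightarrow> comaximal c a"
  unfolding comaximal_def by (metis a_comm m_closed)

text \<open>If \<open>s a + t c = 1\<close>, then \<open>u = t b\<close> and \<open>v = s b\<close> solve the equation \<open>a v + u c = b\<close> for the
  off-diagonal entry.\<close>

lemma dual_split_comaximal:
  assumes "comaximal a c" "a \<in> carrier R" "c \<in> carrier R" "b \<in> carrier R"
  obtains u v where "u \<in> carrier R" "v \<in> carrier R"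
    "dual (a \<otimes> c) b = dual a u \<otimes>\<^bsub>\<T>\<^esub> dual c v"
proof -
  obtain s t where st: "s \<in> carrier R" "t \<in> carrier R" "s \<otimes> a \<oplus> t \<otimes> c = \<one>"
    using assms(1) by (auto simp: comaximal_def)
  have "a \<otimes> (s \<otimes> b) \<oplus> (t \<otimes> b) \<otimes> c = (s \<otimes> a \<oplus> t \<otimes> c) \<otimes> b"
    using st(1,2) assms by algebra
  then have "dual (a \<otimes> c) b = dual a (t \<otimes> b) \<otimes>\<^bsub>\<T>\<^esub> dual c (s \<otimes> b)"
    using st assms by (simp add: dual_mult)
  then show ?thesis using that[of "t \<otimes> b" "s \<otimes> b"] st assms by simp
qed

section \<open>Primary ideals and primary elements\<close>

text \<open>If \<open>b\<close> is invertible modulo \<open>Q\<close>, then \<open>a b \<in> Q\<close> gives \<open>a \<in> Q\<close>; otherwise \<open>b\<close> is nilpotent modulo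
  \<open>Q\<close>. The dichotomy amounts to the radical of \<open>Q\<close> being a maximal ideal, which is the form in which
  it arises here.\<close>

lemma primary_idealI_nilpotent_or_invertible:
  assumes "ideal Q R" "Q \<noteq> carrier R"
    and dichotomy: "\<And>b. b \<in> carrier R \<Longrightarrow>
      (\<exists>n::nat. n \<ge> 1 \<and> b [^] n \<in> Q) \<or> (\<exists>w\<in>carrier R. \<exists>q\<in>Q. w \<otimes> b \<oplus> q = \<one>)"
  shows "primary_ideal Q R"
  unfolding primary_ideal_def
proof (intro conjI ballI impI)
  interpret Q: ideal Q R by fact
  fix a b assume ab: "a \<in> carrier R" "b \<in> carrier R" "a \<otimes> b \<in> Q"
  show "a \<in> Q \<or> (\<exists>n::nat. n \<ge> 1 \<and> b [^] n \<in> Q)"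
  proof (rule disjCI)
    assume "\<not> (\<exists>n::nat. n \<ge> 1 \<and> b [^] n \<in> Q)"
    with dichotomy[OF ab(2)] obtain w q where wq: "w \<in> carrier R" "q \<in> Q" "w \<otimes> b \<oplus> q = \<one>"
      by blast
    have q: "q \<in> carrier R" using wq(2) by (rule Q.Icarr)
    have "w \<otimes> (a \<otimes> b) \<oplus> a \<otimes> q = a \<otimes> (w \<otimes> b \<oplus> q)"
      using ab(1,2) wq(1) q by algebra
    also have "\<dots> = a" using wq(3) ab by simp
    finally show "a \<in> Q"
      using Q.I_l_closed[OF ab(3) wq(1)] Q.I_l_closed[OF wq(2) ab(1)] Q.a_closed by metis
  qed
qed (use assms in auto)

definition primary_product :: "'a \<Rightarrow> bool"
  where "primary_product x \<longleftrightarrow>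
    (\<exists>ys. ys \<noteq> [] \<and> (\<forall>y\<in>set ys. primary_element R y) \<and> x = foldr (\<otimes>) ys \<one>)"

lemma primary_product_single: "primary_element R x \<Longrightarrow> primary_product x"
  unfolding primary_product_def by (intro exI[of _ "[x]"]) (simp add: primary_element_def)

lemma primary_product_mult:
  assumes "primary_product x" "primary_product y"
  shows "primary_product (x \<otimes> y)"
proof -
  obtain xs ys where xs: "xs \<noteq> []" "\<forall>y\<in>set xs. primary_element R y" "x = foldr (\<otimes>) xs \<one>"
    and ys: "ys \<noteq> []" "\<forall>y\<in>set ys. primary_element R y" "y = foldr (\<otimes>) ys \<one>"
    using assms by (auto simp: primary_product_def)
  have carr: "set xs \<subseteq> carrier R" "set ys \<subseteq> carrier R"
    using xs(2) ys(2) by (auto simp: primary_element_def)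
  have "foldr (\<otimes>) (xs @ ys) \<one> = foldr (\<otimes>) xs \<one> \<otimes> foldr (\<otimes>) ys \<one>"
    using carr(1) multlist_closed[OF carr(2)] by (induction xs) (auto simp: m_assoc)
  then show ?thesis
    using xs ys unfolding primary_product_def by (intro exI[of _ "xs @ ys"]) auto
qed

end

context "domain"
begin

lemma zero_not_Unit: "\<zero> \<notin> Units R"
  using Units_r_inv_ex[of \<zero>] by auto

text \<open>For a unit \<open>b\<close> the ideal generated by \<open>b\<epsilon>\<close> is the set of all \<open>d\<epsilon>\<close>. It is the kernel of the
  projection to the diagonal entry, so it is prime because \<open>D\<close> is a domain.\<close>

lemma primary_dual_nilpotent:
  assumes "b \<in> Units R"
  shows "primary_element \<T> (dual \<zero> b)"
proof -
  interpret T: cring \<T> by (rule dual_cring)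
  have b: "b \<in> carrier R" "b \<noteq> \<zero>"
    using assms zero_not_Unit by auto
  have mem: "dual c d \<in> PIdl\<^bsub>\<T>\<^esub> (dual \<zero> b) \<longleftrightarrow> c = \<zero>"
    if "c \<in> carrier R" "d \<in> carrier R" for c d
  proof -
    have "d = (d \<otimes> inv b) \<otimes> b" using that assms b by (simp add: m_assoc)
    then show ?thesis
      using that assms b by (auto simp: dual_PIdl_iff toeplitz_mat_eq_iff
        intro!: bexI[of _ "d \<otimes> inv b"])
  qed
  have nonunit: "dual \<zero> b \<notin> Units \<T>" using b zero_not_Unit by (simp add: dual_Units_iff)
  have "primary_ideal (PIdl\<^bsub>\<T>\<^esub> (dual \<zero> b)) \<T>"
    unfolding primary_ideal_def
  proof (intro conjI ballI impI)
    show "ideal (PIdl\<^bsub>\<T>\<^esub> (dual \<zero> b)) \<T>"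
      using b by (simp add: T.cgenideal_ideal dual_closed)
    show "PIdl\<^bsub>\<T>\<^esub> (dual \<zero> b) \<noteq> carrier \<T>"
      using T.ideal_eq_carrier_iff[of "dual \<zero> b"] nonunit b by (auto simp: dual_closed)
    fix x y assume xy: "x \<in> carrier \<T>" "y \<in> carrier \<T>" "x \<otimes>\<^bsub>\<T>\<^esub> y \<in> PIdl\<^bsub>\<T>\<^esub> (dual \<zero> b)"
    then have "x \<in> PIdl\<^bsub>\<T>\<^esub> (dual \<zero> b) \<or> y \<in> PIdl\<^bsub>\<T>\<^esub> (dual \<zero> b)"
      by (auto elim!: dualE simp: dual_mult mem integral_iff)
    then show "x \<in> PIdl\<^bsub>\<T>\<^esub> (dual \<zero> b) \<or> (\<exists>n::nat. n \<ge> 1 \<and> y [^]\<^bsub>\<T>\<^esub> n \<in> PIdl\<^bsub>\<T>\<^esub> (dual \<zero> b))"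
      using xy(2) by (auto intro!: exI[of _ 1])
  qed
  then show ?thesis
    using b nonunit by (simp add: primary_element_def dual_closed dual_zero toeplitz_mat_eq_iff)
qed

end

section \<open>Dual numbers over a principal ideal domain\<close>

context principal_domain
begin

lemma irreducible_comaximal:
  assumes "p \<in> carrier R" "ring_irreducible p" "c \<in> carrier R" "\<not> p divides c"
  shows "comaximal p c"
proof -
  interpret P: maximalideal "PIdl p" R by (rule irreducible_imp_maximalideal) fact+
  let ?J = "PIdl p <+>\<^bsub>R\<^esub> PIdl c"
  have J: "ideal ?J R" using assms by (simp add: add_ideals cgenideal_ideal)
  have sub: "PIdl p \<subseteq> ?J" "PIdl c \<subseteq> ?J"
    using union_genideal[of "PIdl p" "PIdl c"] genideal_self[of "PIdl p \<union> PIdl c"] assms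
      cgenideal_ideal ideal.Icarr by (metis Un_subset_iff subsetI)+
  have "?J \<noteq> PIdl p"
    using sub(2) assms to_contain_is_to_divide by blast
  then have "?J = carrier R"
    using P.I_maximal[OF J sub(1)] ideal.Icarr[OF J] by blast
  then have "\<one> \<in> ?J" by simp
  then obtain h k where "h \<in> PIdl p" "k \<in> PIdl c" "h \<oplus> k = \<one>"
    unfolding set_add_def' by auto
  then show ?thesis
    unfolding cgenideal_def comaximal_def by auto
qed

lemma properfactor_of_nonunit_mult:
  assumes "q \<in> carrier R" "q \<notin> Units R" "q \<noteq> \<zero>" "m \<in> carrier R" "m \<noteq> \<zero>"
  shows "properfactor (mult_of R) m (q \<otimes> m)"
  by (rule mult_of.properfactorI3[OF m_comm]) (use assms in simp_all)

text \<open>Divisibility is well-founded on the nonzero elements, so dividing by \<open>p\<close> terminates.\<close>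

lemma split_prime_power:
  assumes "p \<in> carrier R" "ring_irreducible p" "a \<in> carrier R" "a \<noteq> \<zero>"
  obtains n :: nat and m where "m \<in> carrier R" "a = p [^] n \<otimes> m" "\<not> p divides m"
proof -
  have p: "p \<noteq> \<zero>" "p \<notin> Units R" using ring_irreducibleE[OF assms(1,2)] by auto
  have "a \<in> carrier R \<Longrightarrow> a \<noteq> \<zero> \<Longrightarrow>
      \<exists>(n::nat) m. m \<in> carrier R \<and> a = p [^] n \<otimes> m \<and> \<not> p divides m"
    using mult_of.division_wellfounded
  proof (induction a rule: wf_induct_rule)
    case (less a)
    show ?case
    proof (cases "p divides a")
      case False
      then show ?thesis using less.prems by (intro exI[of _ 0] exI[of _ a]) simp
    next
      case True
      then obtain a' where a': "a' \<in> carrier R" "a = p \<otimes> a'" by (auto simp: factor_def)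
      then have nz: "a' \<noteq> \<zero>" using less.prems assms(1) by auto
      have "properfactor (mult_of R) a' a"
        using properfactor_of_nonunit_mult[OF assms(1) p(2,1) a'(1) nz] a'(2) by simp
      then obtain n :: nat and m where nm: "m \<in> carrier R" "a' = p [^] n \<otimes> m" "\<not> p divides m"
        using less.IH[of a'] less.prems a' nz by auto
      have "a = p [^] Suc n \<otimes> m"
        using a'(2) nm(1,2) assms(1) by (metis m_assoc m_comm nat_pow_Suc nat_pow_closed)
      then show ?thesis using nm by blast
    qed
  qed
  then show thesis using assms that by blast
qed

text \<open>The norm \<open>a\<^sup>2\<close> puts \<open>p\<^sup>2\<^sup>n\<close> into the ideal \<open>Q\<close> of \<open>a + b\<epsilon>\<close>, so that modulo \<open>Q\<close> divisibility of the
  diagonal entry by \<open>p\<close> decides between nilpotent and invertible elements.\<close>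

lemma primary_dual_prime_power:
  assumes p: "p \<in> carrier R" "ring_irreducible p"
    and a: "a \<in> carrier R" "a \<notin> Units R" "a divides p [^] (n :: nat)" and b: "b \<in> carrier R"
  shows "primary_element \<T> (dual a b)"
proof -
  interpret T: cring \<T> by (rule dual_cring)
  let ?Q = "PIdl\<^bsub>\<T>\<^esub> (dual a b)"
  have p0: "p \<noteq> \<zero>" "p \<notin> Units R" using ring_irreducibleE[OF p] by auto
  interpret Q: ideal ?Q \<T> using a b by (simp add: T.cgenideal_ideal dual_closed)
  obtain e where e: "e \<in> carrier R" "p [^] n = a \<otimes> e" using a(3) by (auto simp: factor_def)
  have "p [^] n \<noteq> \<zero>"
    using p0 p(1) by (induction n) (auto simp: integral_iff)
  then have a0: "a \<noteq> \<zero>" using e by auto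
  have nonunit: "dual a b \<notin> Units \<T>" using a b by (simp add: dual_Units_iff)
  define N where "N = 2 * n"
  have pN: "p [^] N = e \<otimes> e \<otimes> (a \<otimes> a)"
    unfolding N_def mult_2 using p(1) a(1) e
    by (simp flip: nat_pow_mult) algebra
  have "dual (e \<otimes> e) \<zero> \<otimes>\<^bsub>\<T>\<^esub> dual a (\<ominus> b) \<otimes>\<^bsub>\<T>\<^esub> dual a b = dual (p [^] N) \<zero>"
    using a(1) b e(1) by (simp add: dual_mult pN toeplitz_mat_eq_iff) algebra
  then have pow_in: "dual (p [^] N) \<zero> \<in> ?Q"
    using Q.I_l_closed[OF T.cgenideal_self] a(1) b e(1)
    by (metis T.m_closed a_inv_closed dual_closed m_closed zero_closed)
  have "primary_ideal ?Q \<T>"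
  proof (rule T.primary_idealI_nilpotent_or_invertible[OF Q.ideal_axioms])
    show "?Q \<noteq> carrier \<T>"
      using T.ideal_eq_carrier_iff[of "dual a b"] nonunit a b by (auto simp: dual_closed)
    fix z assume "z \<in> carrier \<T>"
    then obtain c d where z: "c \<in> carrier R" "d \<in> carrier R" "z = dual c d" by (rule dualE)
    show "(\<exists>k::nat. k \<ge> 1 \<and> z [^]\<^bsub>\<T>\<^esub> k \<in> ?Q) \<or>
        (\<exists>w\<in>carrier \<T>. \<exists>q\<in>?Q. w \<otimes>\<^bsub>\<T>\<^esub> z \<oplus>\<^bsub>\<T>\<^esub> q = \<one>\<^bsub>\<T>\<^esub>)"
    proof (cases "p divides c")
      case True
      then obtain c' where c': "c' \<in> carrier R" "c = p \<otimes> c'" by (auto simp: factor_def)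
      \<comment> \<open>The cross term \<open>2cd\<epsilon>\<close> of the square inherits the factor \<open>p\<close> from \<open>c\<close>.\<close>
      define y where "y = dual (c' \<otimes> c) (c' \<otimes> d \<oplus> c' \<otimes> d)"
      have y: "y \<in> carrier \<T>" using c' z by (simp add: y_def dual_closed)
      have "z [^]\<^bsub>\<T>\<^esub> (2::nat) = z \<otimes>\<^bsub>\<T>\<^esub> z"
        using \<open>z \<in> carrier \<T>\<close> by (simp add: numeral_2_eq_2)
      also have "\<dots> = dual p \<zero> \<otimes>\<^bsub>\<T>\<^esub> y"
        using c' z p(1) by (simp add: y_def dual_mult toeplitz_mat_eq_iff) algebra
      finally have sq: "z [^]\<^bsub>\<T>\<^esub> (2::nat) = dual p \<zero> \<otimes>\<^bsub>\<T>\<^esub> y" .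
      \<comment> \<open>The exponent \<open>N + 1\<close> makes the power visibly positive, as a primary ideal demands.\<close>
      have "z [^]\<^bsub>\<T>\<^esub> (2 * (N + 1)) = (dual p \<zero> \<otimes>\<^bsub>\<T>\<^esub> y) [^]\<^bsub>\<T>\<^esub> (N + 1)"
        using T.nat_pow_pow[OF \<open>z \<in> carrier \<T>\<close>, of 2 "N + 1"] sq by simp
      also have "\<dots> = (dual p \<zero> \<otimes>\<^bsub>\<T>\<^esub> y [^]\<^bsub>\<T>\<^esub> (N + 1)) \<otimes>\<^bsub>\<T>\<^esub> dual (p [^] N) \<zero>"
        using y p(1) dual_closed[OF p(1) zero_closed] dual_closed[of "p [^] N" \<zero>]
        by (simp add: T.nat_pow_distrib flip: dual_diagonal_power) (simp add: T.m_ac)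
      also have "\<dots> \<in> ?Q"
        using y p(1) by (intro Q.I_l_closed pow_in) (simp add: dual_closed)
      finally show ?thesis
        by (intro disjI1 exI[of _ "2 * (N + 1)"]) simp
    next
      case False
      then have "comaximal c (p [^] N)"
        using irreducible_comaximal[OF p z(1)] comaximal_power comaximal_sym z p by simp
      then have "comaximal (c \<otimes> c) (p [^] N)"
        using comaximal_mult z p by simp
      then obtain s t where st: "s \<in> carrier R" "t \<in> carrier R"
          "s \<otimes> (c \<otimes> c) \<oplus> t \<otimes> p [^] N = \<one>"
        by (auto simp: comaximal_def)
      \<comment> \<open>\<open>w\<close> is \<open>s\<close> times the conjugate \<open>c - d\<epsilon>\<close> of \<open>z\<close>, so that \<open>w z = s c\<^sup>2\<close>.\<close>
      define w where "w = dual (s \<otimes> c) (\<ominus> (s \<otimes> d))"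
      define q where "q = dual t \<zero> \<otimes>\<^bsub>\<T>\<^esub> dual (p [^] N) \<zero>"
      have w: "w \<in> carrier \<T>" using st z by (simp add: w_def dual_closed)
      have q: "q \<in> ?Q" unfolding q_def using st by (intro Q.I_l_closed pow_in) (simp add: dual_closed)
      have wz: "w \<otimes>\<^bsub>\<T>\<^esub> z = dual (s \<otimes> (c \<otimes> c)) \<zero>"
        using st(1) z by (simp add: w_def dual_mult toeplitz_mat_eq_iff) algebra
      have "q = dual (t \<otimes> p [^] N) \<zero>"
        using st p by (simp add: q_def dual_mult)
      with wz have "w \<otimes>\<^bsub>\<T>\<^esub> z \<oplus>\<^bsub>\<T>\<^esub> q = \<one>\<^bsub>\<T>\<^esub>"
        using st z p by (simp add: dual_add dual_one)
      with w q show ?thesis by blast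
    qed
  qed
  then show ?thesis
    using a b a0 nonunit by (simp add: primary_element_def dual_closed dual_zero toeplitz_mat_eq_iff)
qed

text \<open>The common step of both claims: one prime dividing \<open>a\<close> contributes a primary factor \<open>y\<close>, whose
  cofactor has a diagonal entry that is a proper divisor of \<open>a\<close>.\<close>

lemma split_primary_factor:
  assumes "a \<in> carrier R" "a \<noteq> \<zero>" "a \<notin> Units R" "b \<in> carrier R"
  obtains y m v where "primary_element \<T> y" "m \<in> carrier R" "m \<noteq> \<zero>" "v \<in> carrier R"
    "dual a b = y \<otimes>\<^bsub>\<T>\<^esub> dual m v" "properfactor (mult_of R) m a"
proof -
  obtain p where p: "p \<in> carrier R" "ring_irreducible p" "p divides a"
    by (rule exists_irreducible_divisor[of a]) (use assms in auto)
  obtain n :: nat and m where m: "m \<in> carrier R" "a = p [^] n \<otimes> m" "\<not> p divides m"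
    using split_prime_power[OF p(1,2) assms(1,2)] .
  have nz: "p [^] n \<noteq> \<zero>" "m \<noteq> \<zero>"
    using m(1,2) assms(2) p(1) l_null r_null nat_pow_closed by metis+
  have p_nonunit: "p \<notin> Units R" using ring_irreducibleE[OF p(1,2)] by auto
  have "n \<noteq> 0" using m p(3) by (intro notI) simp
  then obtain k where "n = Suc k" using not0_implies_Suc by blast
  then have "p [^] n = p \<otimes> p [^] k" using p(1) by (simp add: m_comm)
  then have nonunit: "p [^] n \<notin> Units R"
    using p_nonunit p(1) unit_factor[of p "p [^] k"] by auto
  have pn: "p [^] n \<in> carrier R" using p(1) by simp
  have comax: "comaximal (p [^] n) m"
    using irreducible_comaximal[OF p(1,2) m(1,3)] p m by (simp add: comaximal_power)
  obtain u v where uv: "u \<in> carrier R" "v \<in> carrier R"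
      "dual (p [^] n \<otimes> m) b = dual (p [^] n) u \<otimes>\<^bsub>\<T>\<^esub> dual m v"
    using dual_split_comaximal[OF comax pn m(1) assms(4)] .
  have "primary_element \<T> (dual (p [^] n) u)"
    by (rule primary_dual_prime_power[OF p(1,2) pn nonunit divides_refl[OF pn] uv(1)])
  moreover have "properfactor (mult_of R) m a"
    unfolding m(2) using properfactor_of_nonunit_mult[OF pn nonunit nz(1) m(1) nz(2)] .
  ultimately show thesis
    using that uv(2,3) m(1) nz(2) unfolding m(2) by blast
qed

lemma primary_of_irreducible:
  assumes "irreducible_element \<T> x"
  shows "primary_element \<T> x"
proof -
  interpret T: cring \<T> by (rule dual_cring)
  have x: "x \<in> carrier \<T>" "x \<notin> Units \<T>"
    and irr: "\<And>y z. y \<in> carrier \<T> \<Longrightarrow> z \<in> carrier \<T> \<Longrightarrow> x = y \<otimes>\<^bsub>\<T>\<^esub> z \<Longrightarrow>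
      PIdl\<^bsub>\<T>\<^esub> y = PIdl\<^bsub>\<T>\<^esub> x \<or> PIdl\<^bsub>\<T>\<^esub> z = PIdl\<^bsub>\<T>\<^esub> x"
    using assms by (auto simp: irreducible_element_def ideal_associated_def)
  obtain a b where ab: "a \<in> carrier R" "b \<in> carrier R" "x = dual a b" using x(1) by (rule dualE)
  have a: "a \<notin> Units R" using x(2) ab by (simp add: dual_Units_iff)
  show ?thesis
  proof (cases "a = \<zero>")
    case True
    have "PIdl\<^bsub>\<T>\<^esub> (dual \<zero> \<one>) = PIdl\<^bsub>\<T>\<^esub> x"
    proof (cases "b = \<zero>")
      case True
      \<comment> \<open>Because of \<open>0 = \<epsilon> \<cdot> \<epsilon>\<close>, zero could only be irreducible if it were associated with \<open>\<epsilon>\<close>.\<close>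
      have "x = dual \<zero> \<one> \<otimes>\<^bsub>\<T>\<^esub> dual \<zero> \<one>"
        using True \<open>a = \<zero>\<close> ab(3) by (simp add: dual_mult)
      then show ?thesis using irr[of "dual \<zero> \<one>" "dual \<zero> \<one>"] by (simp add: dual_closed)
    next
      case False
      have "x = dual b \<zero> \<otimes>\<^bsub>\<T>\<^esub> dual \<zero> \<one>"
        using \<open>a = \<zero>\<close> ab by (simp add: dual_mult)
      moreover have "PIdl\<^bsub>\<T>\<^esub> (dual b \<zero>) \<noteq> PIdl\<^bsub>\<T>\<^esub> x"
      proof
        assume "PIdl\<^bsub>\<T>\<^esub> (dual b \<zero>) = PIdl\<^bsub>\<T>\<^esub> x"
        then have "dual b \<zero> \<in> PIdl\<^bsub>\<T>\<^esub> (dual \<zero> b)"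
          using T.cgenideal_self[of "dual b \<zero>"] ab \<open>a = \<zero>\<close> by (simp add: dual_closed)
        then have "\<zero> divides b" using ab PIdl_dual_imp_divides by blast
        then show False using False zero_divides by blast
      qed
      ultimately show ?thesis
        using irr dual_closed ab(2) zero_closed one_closed by blast
    qed
    then have "dual \<zero> \<one> \<in> PIdl\<^bsub>\<T>\<^esub> (dual \<zero> b)"
      using T.cgenideal_self[of "dual \<zero> \<one>"] ab True by (simp add: dual_closed)
    then have "b \<in> Units R"
      using ab by (auto simp: dual_PIdl_iff toeplitz_mat_eq_iff Units_def m_comm)
    then show ?thesis using primary_dual_nilpotent ab True by simp
  next
    case False
    obtain y m v where y: "primary_element \<T> y" and m: "m \<in> carrier R" "m \<noteq> \<zero>" "v \<in> carrier R"
      and split: "x = y \<otimes>\<^bsub>\<T>\<^esub> dual m v" and proper: "properfactor (mult_of R) m a"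
      using split_primary_factor[OF ab(1) False a ab(2)] ab(3) by metis
    have "PIdl\<^bsub>\<T>\<^esub> (dual m v) \<noteq> PIdl\<^bsub>\<T>\<^esub> x"
    proof
      assume "PIdl\<^bsub>\<T>\<^esub> (dual m v) = PIdl\<^bsub>\<T>\<^esub> x"
      then have "dual m v \<in> PIdl\<^bsub>\<T>\<^esub> (dual a b)"
        using T.cgenideal_self[of "dual m v"] m ab by (simp add: dual_closed)
      then have "a divides m" using ab PIdl_dual_imp_divides by blast
      then show False
        using proper m ab by (auto simp: properfactor_def)
    qed
    then have "PIdl\<^bsub>\<T>\<^esub> y = PIdl\<^bsub>\<T>\<^esub> x"
      using irr[OF _ _ split] y m by (auto simp: primary_element_def dual_closed)
    then show ?thesis
      using y x ab False by (simp add: primary_element_def dual_zero toeplitz_mat_eq_iff)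
  qed
qed

lemma primary_product_nonzero_diagonal:
  assumes "a \<in> carrier R" "a \<noteq> \<zero>" "a \<notin> Units R" "b \<in> carrier R"
  shows "cring.primary_product \<T> (dual a b)"
proof -
  interpret T: cring \<T> by (rule dual_cring)
  show ?thesis
    using mult_of.division_wellfounded assms
  proof (induction a arbitrary: b rule: wf_induct_rule)
    case (less a)
    obtain y m v where y: "primary_element \<T> y" and m: "m \<in> carrier R" "m \<noteq> \<zero>" "v \<in> carrier R"
      and split: "dual a b = y \<otimes>\<^bsub>\<T>\<^esub> dual m v" and proper: "properfactor (mult_of R) m a"
      using split_primary_factor[OF less.prems] .
    show ?case
    proof (cases "m \<in> Units R")
      case True
      \<comment> \<open>A unit cofactor leaves \<open>dual a b\<close> associated with \<open>y\<close>.\<close>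
      have unit: "dual m v \<in> Units \<T>" using True m by (simp add: dual_Units_iff)
      have carr: "y \<in> carrier \<T>" "dual a b \<in> carrier \<T>"
        using y less.prems by (auto simp: primary_element_def dual_closed)
      have "PIdl\<^bsub>\<T>\<^esub> (dual a b) = PIdl\<^bsub>\<T>\<^esub> y"
        using T.associatedI2'[OF split unit carr(1)] T.associated_iff_same_ideal carr by simp
      then have "primary_element \<T> (dual a b)"
        using y less.prems
        by (simp add: primary_element_def dual_closed dual_zero toeplitz_mat_eq_iff dual_Units_iff)
      then show ?thesis by (rule T.primary_product_single)
    next
      case False
      have "T.primary_product (dual m v)"
        using less.IH[of m v] proper less.prems m False by simp
      then show ?thesis
        unfolding split by (rule T.primary_product_mult[OF T.primary_product_single[OF y]])
    qed
  qed
qed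

lemma primary_product_exists:
  assumes "x \<in> carrier \<T>" "x \<noteq> \<zero>\<^bsub>\<T>\<^esub>" "x \<notin> Units \<T>"
  shows "cring.primary_product \<T> x"
proof -
  interpret T: cring \<T> by (rule dual_cring)
  obtain a b where ab: "a \<in> carrier R" "b \<in> carrier R" "x = dual a b" using assms(1) by (rule dualE)
  have a: "a \<notin> Units R" using assms(3) ab by (simp add: dual_Units_iff)
  show ?thesis
  proof (cases "a = \<zero>")
    case False
    then show ?thesis using primary_product_nonzero_diagonal a ab by simp
  next
    case True
    then have b0: "b \<noteq> \<zero>" using assms(2) ab by (auto simp: dual_zero)
    show ?thesis
    proof (cases "b \<in> Units R")
      case True
      then show ?thesis
        using \<open>a = \<zero>\<close> ab by (simp add: T.primary_product_single primary_dual_nilpotent)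
    next
      case False
      have "x = dual b \<zero> \<otimes>\<^bsub>\<T>\<^esub> dual \<zero> \<one>"
        using \<open>a = \<zero>\<close> ab by (simp add: dual_mult)
      then show ?thesis
        using False b0 ab primary_product_nonzero_diagonal
        by (simp add: T.primary_product_mult T.primary_product_single primary_dual_nilpotent)
    qed
  qed
qed

end

theorem corollary11:
  fixes D :: "('a, 'm) ring_scheme"
  assumes "principal_domain D"
  shows "(\<forall>x. irreducible_element (toeplitz_ring D) x \<longrightarrow> primary_element (toeplitz_ring D) x) \<and>
    (\<forall>x \<in> carrier (toeplitz_ring D).
       x \<noteq> \<zero>\<^bsub>toeplitz_ring D\<^esub> \<and> x \<notin> Units (toeplitz_ring D) \<longrightarrow>
       (\<exists>ys. ys \<noteq> [] \<and> (\<forall>y \<in> set ys. primary_element (toeplitz_ring D) y) \<and>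
             x = foldr (\<otimes>\<^bsub>toeplitz_ring D\<^esub>) ys \<one>\<^bsub>toeplitz_ring D\<^esub>))"
proof -
  interpret principal_domain D by fact
  interpret T: cring "toeplitz_ring D" by (rule dual_cring)
  show ?thesis
    using primary_of_irreducible primary_product_exists by (auto simp: T.primary_product_def)
qed

end
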